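(* Let $k\ge 3$ and let $b$ denote a positive integer. Then: (1) $va^\equiv_1(K_{1,1})=1$ and $va^\equiv_1(K_{k*1})=\lceil k/2\rceil$; (2) $va^\equiv_1(K_{2,2})=2$ and $va^\equiv_1(K_{k*2})=k$; (3) if $n=3b$, then $va^\equiv_1(K_{n,n})=p(2b:n,n)$ and $va^\equiv_1(K_{k*n})=p(kb:k*n)$; (4) if $n=3b+1$, then $va^\equiv_1(K_{n,n})=p(2b:n,n)$ and $va^\equiv_1(K_{k*n})=kb+\lceil k/2\rceil$; (5) if $n=3b+2$, then $va^\equiv_1(K_{n,n})=2b+2$ and $va^\equiv_1(K_{k*n})=kb+k$.
   Context: All graphs are finite and simple. For a graph $G$ with $N=|V(G)|$ vertices, an equitable $q$-coloring of $G$ is a partition of $V(G)$ into $q$ (possibly empty) independent sets, each of size $\lfloor N/q\rfloor$ or $\lceil N/q\rceil$. An equitable $(q,r)$-tree-coloring of $G$ is a partition of $V(G)$ into $q$ sets, each of size $\lfloor N/q\rfloor$ or $\lceil N/q\rceil$, such that each set induces a forest of maximum degree at most $r$. The strong equitable vertex $r$-arboricity $va^\equiv_r(G)$ is the minimum $p$ such that $G$ has an equitable $(q,r)$-tree-coloring for every integer $q\ge p$. $K_{n_1,\ldots,n_k}$ is the complete $k$-partite graph with partite sets $X_1,\ldots,X_k$, $|X_i|=n_i$; $K_{k*n}$ denotes the complete $k$-partite graph with every partite set of size $n$ ($k\ge2$). Definition of $p$: suppose $K_{n_1,\ldots,n_k}$ has an equitable $q$-coloring. Then $p(q:n_1,\ldots,n_k)=\lceil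 n_1/d\rceil+\cdots+\lceil n_k/d\rceil$, where $d$ is the minimum integer with $d\ge\lceil (n_1+\cdots+n_k)/q\rceil$ satisfying at least one of: (i) there exist $i\ne j$ such that neither $n_i$ nor $n_j$ is divisible by $d$; (ii) there exists $i$ with $n_i/\lfloor n_i/d\rfloor>d+1$. Also $p(q:k*n)$ denotes $p(q:n,\ldots,n)$ with $k$ entries equal to $n$. *)

theory Defs
  imports Complex_Main "HOL-Library.Disjoint_Sets"
begin

record 'a ugraph =
  verts :: "'a set"
  edges :: "'a set set"

definition simple_graph :: "'a ugraph \<Rightarrow> bool" where
  "simple_graph G \<longleftrightarrow>
     finite (verts G) \<and> (\<forall>e\<in>edges G. e \<subseteq> verts G \<and> card e = 2)"

definition induced_subgraph :: "'a ugraph \<Rightarrow> 'a set \<Rightarrow> 'a ugraph" where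
  "induced_subgraph G S = \<lparr>verts = verts G \<inter> S, edges = {e \<in> edges G. e \<subseteq> S}\<rparr>"

definition independent_set :: "'a ugraph \<Rightarrow> 'a set \<Rightarrow> bool" where
  "independent_set G S \<longleftrightarrow> S \<subseteq> verts G \<and> (\<forall>u\<in>S. \<forall>v\<in>S. {u, v} \<notin> edges G)"

definition degree :: "'a ugraph \<Rightarrow> 'a \<Rightarrow> nat" where
  "degree G v = card {e \<in> edges G. v \<in> e}"

definition is_cycle :: "'a ugraph \<Rightarrow> 'a list \<Rightarrow> bool" where
  "is_cycle G vs \<longleftrightarrow>
     3 \<le> length vs \<and> distinct vs \<and> set vs \<subseteq> verts G \<and>
     (\<forall>i<length vs. {vs ! i, vs ! (Suc i mod length vs)} \<in> edges G)"

definition forest :: "'a ugraph \<Rightarrow> bool" where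
  "forest G \<longleftrightarrow> (\<nexists>vs. is_cycle G vs)"

text \<open>Partitions into \<open>q\<close> sets are indexed families, so that several parts may be empty
  (which is forced when \<open>q\<close> exceeds the number of vertices).\<close>

definition equitable_partition :: "'a set \<Rightarrow> nat \<Rightarrow> (nat \<Rightarrow> 'a set) \<Rightarrow> bool" where
  "equitable_partition V q S \<longleftrightarrow>
     (\<Union>i<q. S i) = V \<and> disjoint_family_on S {..<q} \<and>
     (\<forall>i<q. int (card (S i)) = \<lfloor>real (card V) / real q\<rfloor> \<or>
            int (card (S i)) = \<lceil>real (card V) / real q\<rceil>)"

definition has_equitable_coloring :: "'a ugraph \<Rightarrow> nat \<Rightarrow> bool" where
  "has_equitable_coloring G q \<longleftrightarrow>
     (\<exists>S. equitable_partition (verts G) q S \<and> (\<forall>i<q. independent_set G (S i)))"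

definition has_equitable_tree_coloring :: "'a ugraph \<Rightarrow> nat \<Rightarrow> nat \<Rightarrow> bool" where
  "has_equitable_tree_coloring G q r \<longleftrightarrow>
     (\<exists>S. equitable_partition (verts G) q S \<and>
       (\<forall>i<q. forest (induced_subgraph G (S i)) \<and>
              (\<forall>v \<in> verts (induced_subgraph G (S i)). degree (induced_subgraph G (S i)) v \<le> r)))"

definition strong_equitable_arboricity :: "nat \<Rightarrow> 'a ugraph \<Rightarrow> nat" where
  "strong_equitable_arboricity r G =
     (LEAST p. \<forall>q\<ge>p. has_equitable_tree_coloring G q r)"

text \<open>The \<open>i\<close>-th partite set consists of the pairs \<open>(i, j)\<close> with \<open>j < ns ! i\<close>.\<close>

definition complete_multipartite :: "nat list \<Rightarrow> (nat \<times> nat) ugraph" where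
  "complete_multipartite ns =
     (let V = {(i, j). i < length ns \<and> j < ns ! i}
      in \<lparr>verts = V, edges = {{u, v} | u v. u \<in> V \<and> v \<in> V \<and> fst u \<noteq> fst v}\<rparr>)"

lemma simple_graph_complete_multipartite: "simple_graph (complete_multipartite ns)"
proof -
  have "{(i, j). i < length ns \<and> j < ns ! i} = Sigma {..<length ns} (\<lambda>i. {..<ns ! i})"
    by auto
  then have "finite {(i, j). i < length ns \<and> j < ns ! i}"
    by simp
  then show ?thesis
    by (auto simp: simple_graph_def complete_multipartite_def Let_def card_insert_if)
qed

text \<open>In condition (ii) the quotient \<open>n\<^sub>i / \<lfloor>n\<^sub>i / d\<rfloor>\<close> is read as infinite when
  \<open>\<lfloor>n\<^sub>i / d\<rfloor> = 0\<close>; this case needs its own disjunct because division by zero yields zero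
  in HOL.\<close>

definition p_condition :: "nat list \<Rightarrow> nat \<Rightarrow> bool" where
  "p_condition ns d \<longleftrightarrow>
     (\<exists>i<length ns. \<exists>j<length ns. i \<noteq> j \<and> \<not> d dvd ns ! i \<and> \<not> d dvd ns ! j) \<or>
     (\<exists>i<length ns. ns ! i div d = 0 \<or>
        real (ns ! i) / real (ns ! i div d) > real d + 1)"

definition p_modulus :: "nat \<Rightarrow> nat list \<Rightarrow> nat" where
  "p_modulus q ns =
     (LEAST d. int d \<ge> \<lceil>real (sum_list ns) / real q\<rceil> \<and> p_condition ns d)"

text \<open>\<open>p(q : n\<^sub>1, \<dots>, n\<^sub>k)\<close> is only defined if the graph has an equitable \<open>q\<close>-coloring.\<close>

definition p_number :: "nat \<Rightarrow> nat list \<Rightarrow> nat" where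
  "p_number q ns =
     (if has_equitable_coloring (complete_multipartite ns) q
      then \<Sum>n\<leftarrow>ns. nat \<lceil>real n / real (p_modulus q ns)\<rceil>
      else undefined)"

end

theory Submission
  imports Defs
begin

text \<open>A set of vertices of a complete multipartite graph induces a forest of maximum degree at
  most 1 iff it has at most two elements or lies inside one partite set. Let \<open>N = k n\<close>. For
  \<open>N \<le> 2 q\<close> every equitable partition works; for \<open>2 q \<le> N \<le> 3 q\<close> exactly \<open>N - 2 q\<close> classes are
  triples inside a part, which is possible iff \<open>N - 2 q \<le> k \<lfloor>n / 3\<rfloor>\<close>; for \<open>3 q \<le> N\<close> the colouring
  is a proper equitable colouring. In the last range, suppose \<open>t d < n < (t + 1) d\<close> and
  \<open>k t < q < k (t + 1)\<close>. Some part meets at most \<open>t\<close> classes, so some class has more than \<open>d\<close>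
  elements, hence all classes have at least \<open>d\<close>, so every part contains at most \<open>t\<close> classes, which
  contradicts \<open>k t < q\<close>.\<close>

section \<open>Partitions with prescribed class sizes and equitability\<close>

lemma ex_bounded_summands:
  fixes k q a c :: nat
  assumes "k * a \<le> q" "q \<le> k * c"
  shows "\<exists>t. (\<forall>i<k. a \<le> t i \<and> t i \<le> c) \<and> (\<Sum>i<k. t i) = q"
  using assms
proof (induction k arbitrary: q)
  case 0
  then show ?case by simp
next
  case (Suc k)
  have "k * a \<le> k * c \<and> a \<le> c"
    using Suc.prems by (metis le_trans mult_le_cancel1 zero_less_Suc mult_le_mono2)
  \<comment> \<open>Greedy choice: the largest value up to \<open>c\<close> that still leaves
    \<open>a\<close> for each of the other \<open>k\<close> summands. The rest \<open>q - x\<close>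
    is then \<open>q - c\<close> or exactly \<open>k * a\<close>, and so stays between
    \<open>k * a\<close> and \<open>k * c\<close>.\<close>
  define x where "x = min c (q - k * a)"
  have "k * a \<le> q - x" "q - x \<le> k * c" "x \<le> q" "a \<le> x" "x \<le> c"
    using Suc.prems \<open>k * a \<le> k * c \<and> a \<le> c\<close> unfolding x_def by (auto simp: min_def)
  with Suc.IH obtain t where t: "\<forall>i<k. a \<le> t i \<and> t i \<le> c" "(\<Sum>i<k. t i) = q - x"
    by blast
  show ?case
    by (rule exI[of _ "t(k := x)"])
       (use t \<open>x \<le> q\<close> \<open>a \<le> x\<close> \<open>x \<le> c\<close> in \<open>auto simp: less_Suc_eq\<close>)
qed

lemma ex_partition_with_cards:
  fixes q :: nat
  assumes "finite V" "(\<Sum>i<q. f i) = card V"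
  shows "\<exists>S. (\<Union>i<q. S i) = V \<and> disjoint_family_on S {..<q} \<and> (\<forall>i<q. card (S i) = f i)"
  using assms
proof (induction q arbitrary: V)
  case 0
  then show ?case by (simp add: disjoint_family_on_def)
next
  case (Suc q)
  then have "f q \<le> card V" by simp
  then obtain A where A: "A \<subseteq> V" "card A = f q" "finite A"
    by (rule obtain_subset_with_card_n)
  have "(\<Sum>i<q. f i) = card (V - A)"
    using Suc.prems A by (simp add: card_Diff_subset)
  with Suc obtain S where S: "(\<Union>i<q. S i) = V - A" "disjoint_family_on S {..<q}"
    "\<forall>i<q. card (S i) = f i"
    by (metis finite_Diff)
  have "\<forall>i<q. S i \<inter> A = {}" using S(1) by blast
  then show ?case
    using S A
    by (intro exI[of _ "S(q := A)"])
       (auto simp: less_Suc_eq lessThan_Suc disjoint_family_on_def)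
qed

text \<open>Sizes \<open>m\<close> and \<open>Suc m\<close> force equitability: a class of size
  \<open>m\<close> keeps the total below \<open>(m + 1) * q\<close>, so the floor of the average is
  \<open>m\<close>; a class of size \<open>Suc m\<close> lifts the total above \<open>m * q\<close>,
  so the ceiling is \<open>m + 1\<close>.\<close>

lemma ex_equitable_partition_of_family:
  assumes I: "finite I" "card I = q" and V: "finite V" "(\<Union>i\<in>I. A i) = V"
    and disj: "disjoint_family_on A I"
    and m: "\<And>i. i \<in> I \<Longrightarrow> m \<le> card (A i) \<and> card (A i) \<le> Suc m"
  shows "\<exists>S. equitable_partition V q S \<and> (\<forall>i<q. S i \<in> A ` I)"
proof -
  obtain h where h: "bij_betw h {..<q} I"
    using I by (metis atLeast0LessThan ex_bij_betw_nat_finite)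
  have fin: "finite (A i)" if "i \<in> I" for i
    using that V by (auto intro: finite_subset)
  have cV: "card V = (\<Sum>i\<in>I. card (A i))"
    using card_UN_disjoint[of I A] I fin disj V(2) by (auto simp: disjoint_family_on_def)
  have sz: "int (card (A i)) = \<lfloor>real (card V) / real q\<rfloor> \<or>
      int (card (A i)) = \<lceil>real (card V) / real q\<rceil>" if i: "i \<in> I" for i
  proof -
    have q: "q > 0" using i I by (auto simp: card_gt_0_iff)
    have split: "card V = card (A i) + (\<Sum>j\<in>I - {i}. card (A j))"
      using cV i I by (simp add: sum.remove)
    have cI: "card (I - {i}) = q - 1" using i I by simp
    have lo: "(q - 1) * m \<le> (\<Sum>j\<in>I - {i}. card (A j))"
      using sum_bounded_below[of "I - {i}" m "\<lambda>j. card (A j)"] m cI by simp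
    have hi: "(\<Sum>j\<in>I - {i}. card (A j)) \<le> (q - 1) * Suc m"
      using sum_bounded_above[of "I - {i}" "\<lambda>j. card (A j)" "Suc m"] m cI by simp
    obtain p where p: "q = Suc p" using q by (cases q) auto
    consider "card (A i) = m" | "card (A i) = Suc m" using m[OF i] by linarith
    then show ?thesis
    proof cases
      case 1
      have a: "m * q \<le> card V" "card V < (m + 1) * q"
        using split lo hi 1 unfolding p by (auto simp: algebra_simps)
      then have "card V div q = m"
        by (metis Suc_eq_plus1 div_nat_eqI mult.commute)
      then show ?thesis using 1 by (simp add: floor_divide_of_nat_eq)
    next
      case 2
      have "m * q < card V" "card V \<le> (m + 1) * q"
        using split lo hi 2 unfolding p by (auto simp: algebra_simps)
      then have "real m * real q < real (card V)" "real (card V) \<le> (real m + 1) * real q"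
        by (metis of_nat_less_iff of_nat_mult, metis of_nat_1 of_nat_add of_nat_le_iff of_nat_mult)
      then have "\<lceil>real (card V) / real q\<rceil> = int m + 1"
        using q by (intro ceiling_unique) (auto simp: field_simps)
      then show ?thesis using 2 by simp
    qed
  qed
  have hI: "h i \<in> I" if "i < q" for i using h that by (auto simp: bij_betw_def)
  have "(\<Union>i<q. A (h i)) = V"
    using h V(2) by (auto simp: bij_betw_def)
  moreover have "disjoint_family_on (\<lambda>i. A (h i)) {..<q}"
    using disj h hI unfolding disjoint_family_on_def bij_betw_def inj_on_def
    by (metis lessThan_iff)
  ultimately show ?thesis
    using sz hI by (intro exI[of _ "\<lambda>i. A (h i)"]) (auto simp: equitable_partition_def)
qed

lemma card_le_of_equitable_partition:
  assumes "equitable_partition V q S" "i < q"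
  shows "card V div q \<le> card (S i)" "card (S i) \<le> Suc (card V div q)"
    "card V \<le> m * q \<Longrightarrow> card (S i) \<le> m"
proof -
  let ?x = "real (card V) / real q"
  have fl: "\<lfloor>?x\<rfloor> = int (card V div q)"
    by (simp add: floor_divide_of_nat_eq)
  have ce: "\<lceil>?x\<rceil> \<le> \<lfloor>?x\<rfloor> + 1" "\<lfloor>?x\<rfloor> \<le> \<lceil>?x\<rceil>"
    by linarith+
  have S: "int (card (S i)) = \<lfloor>?x\<rfloor> \<or> int (card (S i)) = \<lceil>?x\<rceil>"
    using assms by (auto simp: equitable_partition_def)
  show "card V div q \<le> card (S i)" "card (S i) \<le> Suc (card V div q)"
    using S fl ce by linarith+
  assume "card V \<le> m * q"
  then have "real (card V) \<le> real m * real q"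
    by (metis of_nat_le_iff of_nat_mult)
  then have "?x \<le> real m" using assms(2) by (simp add: field_simps)
  then have "\<lceil>?x\<rceil> \<le> int m" by (simp add: ceiling_le_iff)
  then show "card (S i) \<le> m" using S ce by linarith
qed

lemma card_mult_le_of_disjoint_family:
  assumes "finite J" "finite X" "disjoint_family_on S J" "\<And>j. j \<in> J \<Longrightarrow> S j \<subseteq> X \<and> d \<le> card (S j)"
  shows "card J * d \<le> card X"
proof -
  have "card J * d \<le> (\<Sum>j\<in>J. card (S j))"
    using sum_bounded_below[of J d "\<lambda>j. card (S j)"] assms(4) by simp
  also have "\<dots> = card (\<Union>j\<in>J. S j)"
  proof (rule card_UN_disjoint[symmetric])
    show "\<forall>j\<in>J. finite (S j)" using assms(2,4) finite_subset by metis
  qed (use assms in \<open>auto simp: disjoint_family_on_def\<close>)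
  also have "\<dots> \<le> card X"
    using assms by (intro card_mono) auto
  finally show ?thesis .
qed

section \<open>Equal parts and forests of maximum degree 1\<close>

abbreviation (input) complete_equipartite :: "nat \<Rightarrow> nat \<Rightarrow> (nat \<times> nat) ugraph" where
  "complete_equipartite k n \<equiv> complete_multipartite (replicate k n)"

lemma verts_complete_equipartite: "verts (complete_equipartite k n) = {..<k} \<times> {..<n}"
  by (auto simp: complete_multipartite_def Let_def)

lemma edges_complete_equipartite:
  "edges (complete_equipartite k n) =
     {{u, v} | u v. u \<in> {..<k} \<times> {..<n} \<and> v \<in> {..<k} \<times> {..<n} \<and> fst u \<noteq> fst v}"
  using verts_complete_equipartite[of k n] by (simp add: complete_multipartite_def Let_def)

lemma card_verts_complete_equipartite [simp]: "card (verts (complete_equipartite k n)) = k * n"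
  by (simp add: verts_complete_equipartite)

lemma independent_set_complete_equipartite:
  assumes "A \<subseteq> {i} \<times> {..<n}" "i < k"
  shows "independent_set (complete_equipartite k n) A"
proof -
  have "fst u = i" if "u \<in> A" for u using assms that by auto
  then show ?thesis
    using assms unfolding independent_set_def verts_complete_equipartite edges_complete_equipartite
    by (auto simp: doubleton_eq_iff)
qed

text \<open>The condition that a tree-coloring with \<open>r = 1\<close> puts on a single
  class.\<close>

definition degree_one_forest :: "'a ugraph \<Rightarrow> 'a set \<Rightarrow> bool" where
  "degree_one_forest G A \<longleftrightarrow> forest (induced_subgraph G A) \<and>
     (\<forall>v \<in> verts (induced_subgraph G A). degree (induced_subgraph G A) v \<le> 1)"

lemma degree_one_forest_independent:
  assumes "independent_set G A" "simple_graph G"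
  shows "degree_one_forest G A"
proof -
  have "edges (induced_subgraph G A) = {}"
  proof (rule ccontr)
    assume "edges (induced_subgraph G A) \<noteq> {}"
    then obtain e where e: "e \<in> edges G" "e \<subseteq> A" by (auto simp: induced_subgraph_def)
    then have "card e = 2" using assms(2) by (simp add: simple_graph_def)
    then obtain u v where "e = {u, v}" by (auto simp: card_2_iff)
    then show False using e assms(1) by (auto simp: independent_set_def)
  qed
  then show ?thesis
    by (auto simp: degree_one_forest_def forest_def is_cycle_def Defs.degree_def
        intro!: exI[of _ 0])
qed

lemma degree_one_forest_card_le_2:
  assumes "finite A" "card A \<le> 2" "simple_graph G"
  shows "degree_one_forest G A"
proof -
  let ?H = "induced_subgraph G A"
  have "\<not> is_cycle ?H vs" for vs
  proof
    assume "is_cycle ?H vs"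
    then have "3 \<le> card (set vs)" "set vs \<subseteq> A"
      by (auto simp: is_cycle_def induced_subgraph_def distinct_card)
    then show False using assms card_mono[of A "set vs"] by linarith
  qed
  moreover have "Defs.degree ?H v \<le> 1" for v
  proof -
    \<comment> \<open>An edge inside \<open>A\<close> has two elements and \<open>A\<close> has at
      most two, so \<open>A\<close> itself is the only possible edge.\<close>
    have "e = A" if "e \<in> edges ?H" for e
      using that assms by (intro card_seteq) (auto simp: induced_subgraph_def simple_graph_def)
    then have "{e \<in> edges ?H. v \<in> e} \<subseteq> {A}" by auto
    from card_mono[OF _ this] show ?thesis by (simp add: Defs.degree_def)
  qed
  ultimately show ?thesis by (simp add: degree_one_forest_def forest_def)
qed

text \<open>A vertex is adjacent to every vertex of the class outside its own part, so the degree
  bound allows at most one of those. Two vertices in different parts leave no room for a third,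
  since it would be a second neighbour of at least one of them.\<close>

lemma degree_one_forest_within_part:
  assumes lin: "degree_one_forest (complete_equipartite k n) A"
    and A: "A \<subseteq> {..<k} \<times> {..<n}" "3 \<le> card A"
  shows "\<exists>i<k. A \<subseteq> {i} \<times> {..<n}"
proof -
  let ?H = "induced_subgraph (complete_equipartite k n) A"
  have no: "v = w" if "u \<in> A" "v \<in> A" "w \<in> A" "fst u \<noteq> fst v" "fst u \<noteq> fst w" for u v w
  proof (rule ccontr)
    assume "v \<noteq> w"
    have "finite A" using A(2) by (intro card_ge_0_finite) simp
    then have fin: "finite {e \<in> edges ?H. u \<in> e}"
      by (auto intro: rev_finite_subset[of "Pow A"] simp: induced_subgraph_def)
    have "{u, x} \<in> edges ?H" if "x \<in> A" "fst u \<noteq> fst x" for x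
    proof -
      have "{u, x} \<in> edges (complete_equipartite k n)"
        unfolding edges_complete_equipartite using that \<open>u \<in> A\<close> A(1) by blast
      then show ?thesis using that \<open>u \<in> A\<close> by (simp add: induced_subgraph_def)
    qed
    then have "{u, v} \<in> edges ?H" "{u, w} \<in> edges ?H" using that by blast+
    then have "{{u, v}, {u, w}} \<subseteq> {e \<in> edges ?H. u \<in> e}" by auto
    from card_mono[OF fin this] have "2 \<le> Defs.degree ?H u"
      using \<open>v \<noteq> w\<close> by (simp add: Defs.degree_def doubleton_eq_iff)
    moreover have "u \<in> verts ?H"
      using that A by (auto simp: induced_subgraph_def verts_complete_equipartite)
    ultimately show False using lin by (auto simp: degree_one_forest_def)
  qed
  obtain T where "T \<subseteq> A" "card T = 3" using A(2) by (rule obtain_subset_with_card_n)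
  then obtain x y z where xyz: "x \<in> A" "y \<in> A" "z \<in> A" "x \<noteq> y" "x \<noteq> z" "y \<noteq> z"
    by (auto simp: card_3_iff)
  have "fst u = fst x" if "u \<in> A" for u
    using no[of u x y] no[of u x z] no[of u y z] no[of x u y] no[of x u z] no[of y u x]
      no[of y u z] xyz that by metis
  then have "A \<subseteq> {fst x} \<times> {..<n}" "fst x < k" using A xyz by force+
  then show ?thesis by blast
qed

section \<open>Constructions of tree-colorings and of proper equitable colorings\<close>

lemma has_equitable_tree_coloringI:
  assumes "equitable_partition (verts G) q S" "\<And>i. i < q \<Longrightarrow> degree_one_forest G (S i)"
  shows "has_equitable_tree_coloring G q 1"
  using assms unfolding has_equitable_tree_coloring_def degree_one_forest_def by blast

lemma has_equitable_tree_coloringE: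
  assumes "has_equitable_tree_coloring G q 1"
  obtains S where "equitable_partition (verts G) q S" "\<And>i. i < q \<Longrightarrow> degree_one_forest G (S i)"
  using assms unfolding has_equitable_tree_coloring_def degree_one_forest_def by blast

lemma has_equitable_tree_coloring_of_equitable_coloring:
  assumes "has_equitable_coloring (complete_multipartite ns) q"
  shows "has_equitable_tree_coloring (complete_multipartite ns) q 1"
  using assms unfolding has_equitable_coloring_def
  by (meson has_equitable_tree_coloringI degree_one_forest_independent
      simple_graph_complete_multipartite)

lemma tree_coloring_pairs:
  assumes "card (verts G) \<le> 2 * q" "0 < q" "simple_graph G"
  shows "has_equitable_tree_coloring G q 1"
proof -
  have fin: "finite (verts G)" using assms by (simp add: simple_graph_def)
  \<comment> \<open>\<open>m\<close> is the smaller class size: 0 if there are at most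
    \<open>q\<close> vertices, where empty classes may occur, and 1 otherwise.\<close>
  obtain m where m: "q * m \<le> card (verts G)" "card (verts G) \<le> q * Suc m" "m \<le> 1"
  proof (cases "card (verts G) \<le> q")
    case True
    then show ?thesis using that[of 0] by simp
  next
    case False
    then show ?thesis using that[of 1] assms by simp
  qed
  obtain f where f: "\<forall>i<q. m \<le> f i \<and> f i \<le> Suc m" "(\<Sum>i<q. f i) = card (verts G)"
    using ex_bounded_summands[OF m(1,2)] by blast
  obtain A where A: "(\<Union>i<q. A i) = verts G" "disjoint_family_on A {..<q}" "\<forall>i<q. card (A i) = f i"
    using ex_partition_with_cards[OF fin f(2)] by blast
  obtain S where S: "equitable_partition (verts G) q S" "\<forall>i<q. S i \<in> A ` {..<q}"
    using ex_equitable_partition_of_family[of "{..<q}" q "verts G" A m] fin A f by auto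
  show ?thesis
  proof (rule has_equitable_tree_coloringI[OF S(1)])
    fix i assume "i < q"
    then obtain j where j: "j < q" "S i = A j" using S(2) by auto
    then have "card (S i) \<le> 2" using A(3) f(1) m(3) by fastforce
    moreover have "finite (S i)" using j A(1) fin by (auto intro: finite_subset)
    ultimately show "degree_one_forest G (S i)"
      using assms(3) by (intro degree_one_forest_card_le_2)
  qed
qed

text \<open>Part \<open>i\<close> is cut into \<open>t i\<close> classes of sizes \<open>m\<close>
  and \<open>Suc m\<close>, which needs \<open>t i * m \<le> n \<le> t i * Suc m\<close>. The two
  bounds on \<open>n\<close> are these inequalities at the extreme values \<open>t1\<close> and
  \<open>t0\<close>, and any \<open>q\<close> between \<open>k * t0\<close> and
  \<open>k * t1\<close> is a sum of admissible \<open>t i\<close>.\<close>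

lemma equitable_coloring_complete_equipartite:
  assumes q: "k * t0 \<le> q" "q \<le> k * t1" and n: "n \<le> t0 * Suc m" "t1 * m \<le> n"
  shows "has_equitable_coloring (complete_equipartite k n) q"
proof -
  obtain t where t: "\<forall>i<k. t0 \<le> t i \<and> t i \<le> t1" "(\<Sum>i<k. t i) = q"
    using ex_bounded_summands[OF q] by blast
  have "\<exists>S. (\<Union>j<t i. S j) = {i} \<times> {..<n} \<and> disjoint_family_on S {..<t i} \<and>
          (\<forall>j<t i. m \<le> card (S j) \<and> card (S j) \<le> Suc m)" if i: "i < k" for i
  proof -
    have "t i * m \<le> n" "n \<le> t i * Suc m"
      using n t(1) i by (meson le_trans mult_le_mono1)+
    then obtain f where f: "\<forall>j<t i. m \<le> f j \<and> f j \<le> Suc m" "(\<Sum>j<t i. f j) = n"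
      using ex_bounded_summands by blast
    have "(\<Sum>j<t i. f j) = card ({i} \<times> {..<n})" using f(2) by simp
    from ex_partition_with_cards[OF _ this] obtain S where
      "(\<Union>j<t i. S j) = {i} \<times> {..<n}" "disjoint_family_on S {..<t i}" "\<forall>j<t i. card (S j) = f j"
      by auto
    then show ?thesis using f(1) by (intro exI[of _ S]) simp
  qed
  then obtain S where S: "\<And>i. i < k \<Longrightarrow> (\<Union>j<t i. S i j) = {i} \<times> {..<n} \<and>
      disjoint_family_on (S i) {..<t i} \<and> (\<forall>j<t i. m \<le> card (S i j) \<and> card (S i j) \<le> Suc m)"
    by metis
  let ?I = "Sigma {..<k} (\<lambda>i. {..<t i})" and ?A = "\<lambda>(i, j). S i j"
  have sub: "S i j \<subseteq> {i} \<times> {..<n}" if "i < k" "j < t i" for i j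
    using S[OF that(1)] that(2) by blast
  have un: "(\<Union>x\<in>?I. ?A x) = {..<k} \<times> {..<n}" (is "?L = _")
  proof -
    have "?L = (\<Union>i<k. \<Union>j<t i. S i j)" by auto
    also have "\<dots> = (\<Union>i<k. {i} \<times> {..<n})" using S by auto
    finally show ?thesis by auto
  qed
  have disj: "disjoint_family_on ?A ?I"
    unfolding disjoint_family_on_def
  proof (intro ballI impI)
    fix x y assume x: "x \<in> ?I" and y: "y \<in> ?I" and "x \<noteq> y"
    obtain i j i' j' where e: "x = (i, j)" "y = (i', j')" by (cases x, cases y) auto
    show "?A x \<inter> ?A y = {}"
    proof (cases "i = i'")
      case True
      then show ?thesis using e x y \<open>x \<noteq> y\<close> S[of i] by (auto simp: disjoint_family_on_def)
    next
      case False
      then show ?thesis using e x y sub[of i j] sub[of i' j'] by auto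
    qed
  qed
  have sz: "m \<le> card (?A x) \<and> card (?A x) \<le> Suc m" if "x \<in> ?I" for x
    using that S[of "fst x"] by (cases x) simp
  have fin: "finite ?I" "card ?I = q" "finite ({..<k} \<times> {..<n})"
    using t(2) by (simp_all add: card_SigmaI)
  have "\<exists>R. equitable_partition ({..<k} \<times> {..<n}) q R \<and> (\<forall>i<q. R i \<in> ?A ` ?I)"
    using fin un disj sz by (rule ex_equitable_partition_of_family)
  then obtain R where
    R: "equitable_partition ({..<k} \<times> {..<n}) q R" "\<forall>i<q. R i \<in> ?A ` ?I"
    by (elim exE conjE)
  have "independent_set (complete_equipartite k n) (R i)" if i: "i < q" for i
  proof -
    have "R i \<in> ?A ` ?I" using R(2) i by simp
    then show ?thesis
    proof (rule imageE)
      fix x assume "R i = ?A x" "x \<in> ?I"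
      then have "R i \<subseteq> {fst x} \<times> {..<n}" "fst x < k"
        using sub[of "fst x" "snd x"] by (cases x; simp)+
      then show ?thesis by (rule independent_set_complete_equipartite)
    qed
  qed
  then show ?thesis
    using R(1) unfolding has_equitable_coloring_def verts_complete_equipartite by blast
qed

lemma tree_coloring_pairs_and_triples:
  assumes N: "2 * q \<le> k * n" "k * n \<le> 3 * q" "k * n \<le> 2 * q + k * (n div 3)"
  shows "has_equitable_tree_coloring (complete_equipartite k n) q 1"
proof -
  \<comment> \<open>\<open>T\<close> triples and \<open>q - T\<close> pairs cover
    \<open>3 * T + 2 * (q - T)\<close> vertices. Equating this with \<open>k * n\<close> gives
    \<open>T\<close>, and the number of pairs becomes \<open>3 * q - k * n\<close>.\<close>
  define T where "T = k * n - 2 * q"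
  let ?V = "{..<k} \<times> {..<n}"
  have "k * 0 \<le> T" "T \<le> k * (n div 3)" using N by (auto simp: T_def)
  then obtain t where t: "\<forall>i<k. t i \<le> n div 3" "(\<Sum>i<k. t i) = T"
    using ex_bounded_summands by blast
  have "\<exists>S. (\<forall>j<t i. S j \<subseteq> {i} \<times> {..<n} \<and> card (S j) = 3) \<and> disjoint_family_on S {..<t i}"
    if i: "i < k" for i
  proof -
    have "3 * t i \<le> n" using t(1) i by fastforce
    \<comment> \<open>The extra class of index \<open>t i\<close> collects the rest of the part so
      that the sizes add up to \<open>n\<close>. It is dropped afterwards, and its vertices go into
      pairs that may meet two parts.\<close>
    then have "(\<Sum>j<Suc (t i). if j < t i then 3 else n - 3 * t i) = card ({i} \<times> {..<n})"
      by simp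
    from ex_partition_with_cards[OF _ this] obtain S where
      S: "(\<Union>j<Suc (t i). S j) = {i} \<times> {..<n}" "disjoint_family_on S {..<Suc (t i)}"
        "\<forall>j<Suc (t i). card (S j) = (if j < t i then 3 else n - 3 * t i)"
      by auto
    have "S j \<subseteq> {i} \<times> {..<n} \<and> card (S j) = 3" if "j < t i" for j
    proof
      show "S j \<subseteq> {i} \<times> {..<n}" unfolding S(1)[symmetric] using that by (auto intro: less_SucI)
      show "card (S j) = 3" using S(3) that by simp
    qed
    moreover have "disjoint_family_on S {..<t i}"
      by (rule disjoint_family_on_mono[OF _ S(2)]) auto
    ultimately show ?thesis by blast
  qed
  then obtain S where S: "\<And>i. i < k \<Longrightarrow> (\<forall>j<t i. S i j \<subseteq> {i} \<times> {..<n} \<and> card (S i j) = 3) \<and>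
      disjoint_family_on (S i) {..<t i}"
    by metis
  let ?I = "Sigma {..<k} (\<lambda>i. {..<t i})"
  define A where "A = (\<lambda>(i, j). S i j)"
  have sub: "A x \<subseteq> {fst x} \<times> {..<n}" "card (A x) = 3" "fst x < k" if "x \<in> ?I" for x
    using that S[of "fst x"] by (cases x; simp add: A_def)+
  have disj: "A x \<inter> A y = {}" if "x \<in> ?I" "y \<in> ?I" "x \<noteq> y" for x y
  proof (cases "fst x = fst y")
    case True
    then show ?thesis using that S[of "fst x"]
      by (cases x, cases y) (auto simp: A_def disjoint_family_on_def)
  next
    case False
    then show ?thesis using sub(1)[OF that(1)] sub(1)[OF that(2)] by auto
  qed
  have cI: "card ?I = T" using t by (simp add: card_SigmaI)
  have AV: "A x \<subseteq> ?V" if "x \<in> ?I" for x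
    using sub(1,3)[OF that] by auto
  have finA: "finite (A x)" if "x \<in> ?I" for x
    using AV[OF that] by (rule finite_subset) simp
  have "card (\<Union>x\<in>?I. A x) = (\<Sum>x\<in>?I. card (A x))"
    using finA disj by (intro card_UN_disjoint) auto
  also have "\<dots> = 3 * T" using sub(2) cI by simp
  finally have "card (\<Union>x\<in>?I. A x) = 3 * T" .
  then have "card (?V - (\<Union>x\<in>?I. A x)) = k * n - 3 * T"
    using AV finA by (subst card_Diff_subset) auto
  also have "\<dots> = (\<Sum>i<3 * q - k * n. 2)" using N by (simp add: T_def)
  finally obtain B where B: "(\<Union>i<3 * q - k * n. B i) = ?V - (\<Union>x\<in>?I. A x)"
    "disjoint_family_on B {..<3 * q - k * n}" "\<forall>i<3 * q - k * n. card (B i) = 2"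
    using ex_partition_with_cards[of "?V - (\<Union>x\<in>?I. A x)" "\<lambda>_. 2" "3 * q - k * n"] by auto
  let ?J = "?I <+> {..<3 * q - k * n}" and ?C = "case_sum A B"
  have un: "(\<Union>x\<in>?J. ?C x) = ?V"
  proof -
    have "(\<Union>x\<in>?J. ?C x) = (\<Union>x\<in>?I. A x) \<union> (\<Union>i<3 * q - k * n. B i)"
      unfolding Plus_def by auto
    also have "\<dots> = ?V" using B(1) AV by blast
    finally show ?thesis .
  qed
  have AB: "A x \<inter> B i = {}" if "x \<in> ?I" "i < 3 * q - k * n" for x i
    using B(1) that by blast
  have dJ: "disjoint_family_on ?C ?J"
    unfolding disjoint_family_on_def
  proof (intro ballI impI)
    fix x y assume "x \<in> ?J" "y \<in> ?J" "x \<noteq> y"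
    then show "?C x \<inter> ?C y = {}"
      using disj AB B(2) unfolding disjoint_family_on_def
      by (elim PlusE) (simp_all add: Int_commute)
  qed
  have "card ?J = q"
    using N cI by (subst card_Plus) (auto simp: T_def)
  moreover have "2 \<le> card (?C x) \<and> card (?C x) \<le> Suc 2" if "x \<in> ?J" for x
    using that sub(2) B(3) by (elim PlusE) simp_all
  ultimately obtain R where R: "equitable_partition ?V q R" "\<forall>i<q. R i \<in> ?C ` ?J"
    using ex_equitable_partition_of_family[OF _ _ _ un dJ, of q 2] by auto
  show ?thesis
  proof (rule has_equitable_tree_coloringI)
    show "equitable_partition (verts (complete_equipartite k n)) q R"
      using R(1) by (simp add: verts_complete_equipartite)
    fix i assume "i < q"
    then obtain x where x: "x \<in> ?J" "R i = ?C x" using R(2) by blast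
    from x(1) show "degree_one_forest (complete_equipartite k n) (R i)"
    proof (rule PlusE)
      fix y assume "y \<in> ?I" "x = Inl y"
      then show ?thesis using x(2) sub(1,3)[of y]
        by (auto intro!: degree_one_forest_independent simple_graph_complete_multipartite
            independent_set_complete_equipartite)
    next
      fix y assume "y \<in> {..<3 * q - k * n}" "x = Inr y"
      then have "card (R i) = 2" using x(2) B(3) by simp
      then show ?thesis
        by (intro degree_one_forest_card_le_2 simple_graph_complete_multipartite)
           (auto intro: card_ge_0_finite)
    qed
  qed
qed

section \<open>Obstructions to tree-colorings\<close>

lemma tree_coloring_triples_bound:
  assumes "has_equitable_tree_coloring (complete_equipartite k n) q 1" "k * n \<le> 3 * q"
  shows "k * n \<le> 2 * q + k * (n div 3)"
proof -
  obtain S where S: "equitable_partition ({..<k} \<times> {..<n}) q S"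
    "\<And>i. i < q \<Longrightarrow> degree_one_forest (complete_equipartite k n) (S i)"
    using has_equitable_tree_coloringE[OF assms(1)] by (metis verts_complete_equipartite)
  have un: "(\<Union>i<q. S i) = {..<k} \<times> {..<n}" and disj: "disjoint_family_on S {..<q}"
    using S(1) by (auto simp: equitable_partition_def)
  define D where "D i = {j. j < q \<and> 3 \<le> card (S j) \<and> S j \<subseteq> {i} \<times> {..<n}}" for i
  have finS: "finite (S j)" if "j < q" for j
    using that un by (intro finite_subset[of "S j" "{..<k} \<times> {..<n}"]) auto
  have D: "card (D i) \<le> n div 3" for i
  proof -
    have "card (D i) * 3 \<le> card ({i} \<times> {..<n})"
      using disj by (intro card_mult_le_of_disjoint_family)
        (auto simp: D_def intro: disjoint_family_on_mono[of _ "{..<q}"])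
    then show ?thesis by simp
  qed
  have "k * n = card (\<Union>i<q. S i)" using un by simp
  also have "\<dots> = (\<Sum>j<q. card (S j))"
    using disj finS by (intro card_UN_disjoint) (auto simp: disjoint_family_on_def)
  \<comment> \<open>No class has more than three vertices, so a size exceeds two by at most 1, and
    only for triples. Each triple lies in one part, and a part has room for at most
    \<open>n div 3\<close> of them.\<close>
  also have "\<dots> \<le> (\<Sum>j<q. 2 + (if 3 \<le> card (S j) then 1 else 0))"
    using card_le_of_equitable_partition(3)[OF S(1), of _ 3] assms(2)
    by (intro sum_mono) fastforce
  also have "\<dots> = 2 * q + card {j. j < q \<and> 3 \<le> card (S j)}"
    by (subst sum.distrib) (simp add: sum.If_cases Int_def)
  also have "{j. j < q \<and> 3 \<le> card (S j)} \<subseteq> (\<Union>i<k. D i)"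
  proof
    fix j assume "j \<in> {j. j < q \<and> 3 \<le> card (S j)}"
    then have j: "j < q" "3 \<le> card (S j)" by auto
    then have "S j \<subseteq> {..<k} \<times> {..<n}" using un by blast
    then obtain i where "i < k" "S j \<subseteq> {i} \<times> {..<n}"
      using degree_one_forest_within_part[OF S(2)[OF j(1)]] j(2) by blast
    then show "j \<in> (\<Union>i<k. D i)" using j by (auto simp: D_def)
  qed
  then have "card {j. j < q \<and> 3 \<le> card (S j)} \<le> card (\<Union>i<k. D i)"
    by (intro card_mono) (auto simp: D_def)
  also have "\<dots> \<le> (\<Sum>i<k. card (D i))" by (rule card_UN_le) simp
  also have "\<dots> \<le> k * (n div 3)"
    using sum_bounded_above[of "{..<k}" "\<lambda>i. card (D i)" "n div 3"] D by simp
  finally show ?thesis by simp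
qed

lemma no_tree_coloring_between:
  assumes q3: "3 * q \<le> k * n" and n: "t * d < n" "n < Suc t * d"
    and q: "k * t < q" "q < k * Suc t"
  shows "\<not> has_equitable_tree_coloring (complete_equipartite k n) q 1"
proof
  assume "has_equitable_tree_coloring (complete_equipartite k n) q 1"
  then obtain S where S: "equitable_partition ({..<k} \<times> {..<n}) q S"
    "\<And>i. i < q \<Longrightarrow> degree_one_forest (complete_equipartite k n) (S i)"
    by (metis has_equitable_tree_coloringE verts_complete_equipartite)
  have un: "(\<Union>i<q. S i) = {..<k} \<times> {..<n}" and disj: "disjoint_family_on S {..<q}"
    using S(1) by (auto simp: equitable_partition_def)
  define s where "s = k * n div q"
  have s: "s \<le> card (S j)" "card (S j) \<le> Suc s" if "j < q" for j
    using card_le_of_equitable_partition(1,2)[OF S(1) that] by (auto simp: s_def)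
  \<comment> \<open>As every class has at least three vertices, it lies inside one part; each part
    is then the disjoint union of the classes in \<open>C i\<close>.\<close>
  have "3 \<le> s" using q3 q(1) by (simp add: s_def less_eq_div_iff_mult_less_eq)
  define C where "C i = {j. j < q \<and> S j \<subseteq> {i} \<times> {..<n}}" for i
  have finC: "finite (C i)" for i by (simp add: C_def)
  have finS: "finite (S j)" if "j < q" for j
    using that un by (intro finite_subset[of "S j" "{..<k} \<times> {..<n}"]) auto
  have ex: "\<exists>i<k. S j \<subseteq> {i} \<times> {..<n}" if "j < q" for j
    using degree_one_forest_within_part[OF S(2)[OF that]] un s(1)[OF that] \<open>3 \<le> s\<close> that by auto
  have ne: "S j \<noteq> {}" if "j < q" for j using s(1)[OF that] \<open>3 \<le> s\<close> by auto
  have "(\<Union>i<k. C i) = {..<q}" using ex by (auto simp: C_def)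
  moreover have "C i \<inter> C j = {}" if "i \<noteq> j" for i j
    using ne that unfolding C_def by fastforce
  ultimately have sumC: "(\<Sum>i<k. card (C i)) = q"
    using card_UN_disjoint[of "{..<k}" C] finC by auto
  have part: "(\<Union>j\<in>C i. S j) = {i} \<times> {..<n}" if i: "i < k" for i
  proof
    show "{i} \<times> {..<n} \<subseteq> (\<Union>j\<in>C i. S j)"
    proof
      fix x assume x: "x \<in> {i} \<times> {..<n}"
      then have "x \<in> (\<Union>j<q. S j)" unfolding un using i by auto
      then obtain j where j: "j < q" "x \<in> S j" by auto
      then obtain i' where "S j \<subseteq> {i'} \<times> {..<n}" using ex by blast
      moreover from this have "i' = i" using x j by auto
      ultimately show "x \<in> (\<Union>j\<in>C i. S j)" using j by (auto simp: C_def)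
    qed
  qed (auto simp: C_def)
  have "\<exists>i<k. card (C i) \<le> t"
  proof (rule ccontr)
    assume "\<not> ?thesis"
    then have "k * Suc t \<le> (\<Sum>i<k. card (C i))"
      using sum_bounded_below[of "{..<k}" "Suc t" "\<lambda>i. card (C i)"] by (simp add: not_le Suc_le_eq)
    then show False using sumC q by simp
  qed
  then obtain i where i: "i < k" "card (C i) \<le> t" by blast
  have "n = card (\<Union>j\<in>C i. S j)" using part[OF i(1)] by simp
  also have "\<dots> = (\<Sum>j\<in>C i. card (S j))"
    using disj finC finS by (intro card_UN_disjoint) (auto simp: disjoint_family_on_def C_def)
  also have "\<dots> \<le> card (C i) * Suc s"
    using sum_bounded_above[of "C i" "\<lambda>j. card (S j)" "Suc s"] s(2) by (simp add: C_def)
  also have "\<dots> \<le> t * Suc s" using i(2) by (rule mult_le_mono1)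
  \<comment> \<open>A part with at most \<open>t\<close> classes of at most \<open>Suc s\<close>
    vertices pushes the smaller class size \<open>s\<close> up to at least \<open>d\<close>, and by
    equitability this holds in all parts.\<close>
  finally have "t * d < t * Suc s" using n(1) by simp
  then have "d \<le> s" by (metis less_Suc_eq_le mult_less_cancel1)
  \<comment> \<open>With at least \<open>d\<close> vertices per class, \<open>Suc t\<close> classes
    would overfill a part, so all parts together hold at most \<open>k * t < q\<close>
    classes.\<close>
  have "card (C i) \<le> t" if "i < k" for i
  proof -
    have "card (C i) * d \<le> card ({i} \<times> {..<n})"
      using disj finC s(1) \<open>d \<le> s\<close> by (intro card_mult_le_of_disjoint_family)
        (auto simp: C_def intro: disjoint_family_on_mono[of _ "{..<q}"] le_trans)
    then have "card (C i) * d < Suc t * d" using n(2) by simp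
    then show ?thesis by (metis less_Suc_eq_le mult_less_cancel2)
  qed
  then have "(\<Sum>i<k. card (C i)) \<le> k * t"
    using sum_bounded_above[of "{..<k}" "\<lambda>i. card (C i)" t] by simp
  then show False using sumC q by simp
qed

lemma no_tree_coloring_0:
  assumes "0 < k" "0 < n"
  shows "\<not> has_equitable_tree_coloring (complete_equipartite k n) 0 1"
  using assms by (auto simp: has_equitable_tree_coloring_def equitable_partition_def
      verts_complete_equipartite)

section \<open>Thresholds for part sizes with remainder 1 or 2 modulo 3\<close>

lemma strong_equitable_arboricity_eqI:
  assumes "\<And>q. p \<le> q \<Longrightarrow> has_equitable_tree_coloring G q r"
    and "\<not> has_equitable_tree_coloring G (p - 1) r" "0 < p"
  shows "strong_equitable_arboricity r G = p"
  unfolding strong_equitable_arboricity_def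
proof (rule Least_equality)
  fix p' assume "\<forall>q\<ge>p'. has_equitable_tree_coloring G q r"
  \<comment> \<open>A threshold \<open>p' \<le> p - 1\<close> would cover the color number
    \<open>p - 1\<close>, so this one failure excludes all smaller thresholds.\<close>
  then have "\<not> p' \<le> p - 1" using assms(2) by blast
  then show "p \<le> p'" by simp
qed (use assms in blast)

lemma tree_coloring_large:
  assumes "0 < q" "k * n \<le> 3 * q" "k * n \<le> 2 * q + k * (n div 3)"
  shows "has_equitable_tree_coloring (complete_equipartite k n) q 1"
proof (cases "k * n \<le> 2 * q")
  case True
  then show ?thesis using assms
    by (intro tree_coloring_pairs simple_graph_complete_multipartite) auto
next
  case False
  then show ?thesis using assms by (intro tree_coloring_pairs_and_triples) auto
qed

text \<open>For \<open>k * n \<le> 3 * q\<close> the parts cannot supply enough triples. Otherwise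
  \<open>d = 3\<close> and \<open>t = n div 3\<close> fit the gap between \<open>k * t\<close> and
  \<open>k * Suc t\<close>, since the remainder places \<open>n\<close> strictly between
  \<open>3 * t\<close> and \<open>3 * Suc t\<close>.\<close>

lemma no_tree_coloring_of_remainder:
  assumes "n mod 3 \<noteq> 0" "k * (n div 3) < q" "q < k * Suc (n div 3)" "2 * q + k * (n div 3) < k * n"
  shows "\<not> has_equitable_tree_coloring (complete_equipartite k n) q 1"
proof (cases "k * n \<le> 3 * q")
  case True
  then show ?thesis using tree_coloring_triples_bound assms(4) by fastforce
next
  case False
  have "n div 3 * 3 < n" "n < Suc (n div 3) * 3" using assms(1) by presburger+
  then show ?thesis using False assms by (intro no_tree_coloring_between) auto
qed

text \<open>The triple bound \<open>k * n \<le> 2 * q + k * b\<close> here reads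
  \<open>q \<ge> k * b + k\<close>.\<close>

lemma arboricity_remainder_2:
  assumes "2 \<le> k" "n = 3 * b + 2"
  shows "strong_equitable_arboricity 1 (complete_equipartite k n) = k * b + k"
proof (rule strong_equitable_arboricity_eqI)
  have d: "n div 3 = b" "n mod 3 = 2" using assms(2) by presburger+
  fix q assume q: "k * b + k \<le> q"
  show "has_equitable_tree_coloring (complete_equipartite k n) q 1"
    by (rule tree_coloring_large, unfold d) (use q assms(1) in \<open>auto simp: assms(2) algebra_simps\<close>)
next
  have d: "n div 3 = b" "n mod 3 = 2" using assms(2) by presburger+
  show "\<not> has_equitable_tree_coloring (complete_equipartite k n) (k * b + k - 1) 1"
    by (rule no_tree_coloring_of_remainder, unfold d) (use assms in \<open>auto simp: algebra_simps\<close>)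
qed (use assms in auto)

text \<open>The triple bound here reads \<open>2 * q \<ge> 2 * k * b + k\<close>, whence the ceiling
  of \<open>k / 2\<close>. For \<open>k = 2\<close> and \<open>b \<ge> 1\<close> the color number
  just below would be \<open>2 * b\<close>, for which a proper equitable coloring exists; that case
  leads to \<open>p\<close> instead.\<close>

lemma arboricity_remainder_1:
  assumes "2 \<le> k" "n = 3 * b + 1" "3 \<le> k \<or> b = 0"
  shows "strong_equitable_arboricity 1 (complete_equipartite k n) = k * b + nat \<lceil>real k / 2\<rceil>"
proof -
  have d: "n div 3 = b" "n mod 3 = 1" using assms(2) by auto
  have "\<lceil>real k / 2\<rceil> = int ((k + 1) div 2)"
    by (cases "even k") (auto elim!: evenE oddE intro!: ceiling_unique)
  then have c: "nat \<lceil>real k / 2\<rceil> = (k + 1) div 2" by simp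
  show ?thesis
    unfolding c
  proof (rule strong_equitable_arboricity_eqI)
    fix q assume q: "k * b + (k + 1) div 2 \<le> q"
    show "has_equitable_tree_coloring (complete_equipartite k n) q 1"
      by (rule tree_coloring_large, unfold d) (use q assms(1) in \<open>auto simp: assms(2) algebra_simps\<close>)
  next
    show "\<not> has_equitable_tree_coloring (complete_equipartite k n) (k * b + (k + 1) div 2 - 1) 1"
    proof (cases "3 \<le> k")
      case True
      then show ?thesis
        by (intro no_tree_coloring_of_remainder; unfold d) (auto simp: assms(2) algebra_simps)
    next
      case False
      \<comment> \<open>Here \<open>k = 2\<close> and \<open>b = 0\<close>, so the claimed value is
        1 and it remains to exclude a coloring with 0 classes.\<close>
      then have "k * b + (k + 1) div 2 - 1 = 0" using assms by auto
      then show ?thesis using no_tree_coloring_0[of k n] assms by simp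
    qed
  qed (use assms in auto)
qed

section \<open>The number \<open>p\<close> for equal parts and its equality with the
  arboricity\<close>

text \<open>For equal part sizes condition (ii) on \<open>d\<close> follows from condition (i).\<close>

lemma p_condition_replicate:
  assumes "2 \<le> k" "0 < d" "0 < n"
  shows "p_condition (replicate k n) d \<longleftrightarrow> \<not> d dvd n"
proof
  assume "\<not> d dvd n"
  then have "\<exists>i<k. \<exists>j<k. i \<noteq> j \<and> \<not> d dvd replicate k n ! i \<and> \<not> d dvd replicate k n ! j"
    using assms(1) by (intro exI[of _ 0] conjI exI[of _ 1]) auto
  then show "p_condition (replicate k n) d" by (simp add: p_condition_def)
next
  assume p: "p_condition (replicate k n) d"
  show "\<not> d dvd n"
  proof
    assume "d dvd n"
    then obtain e where e: "n = d * e" by blast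
    then show False using p assms by (auto simp: p_condition_def)
  qed
qed

text \<open>The modulus in the form used later: the least non-divisor of \<open>n\<close> from
  \<open>k * n / q\<close> on.\<close>

lemma p_modulus_replicate:
  assumes "2 \<le> k" "0 < n" "0 < q"
  defines "d \<equiv> p_modulus q (replicate k n)"
  shows "k * n \<le> d * q" "\<not> d dvd n" "\<And>e. k * n \<le> e * q \<Longrightarrow> e < d \<Longrightarrow> e dvd n"
proof -
  define P where "P e \<longleftrightarrow> int e \<ge> \<lceil>real (sum_list (replicate k n)) / real q\<rceil> \<and>
      p_condition (replicate k n) e" for e
  have ce: "int e \<ge> \<lceil>real (sum_list (replicate k n)) / real q\<rceil> \<longleftrightarrow> k * n \<le> e * q" for e
  proof -
    have "int e \<ge> \<lceil>real (sum_list (replicate k n)) / real q\<rceil> \<longleftrightarrow> real k * real n \<le> real e * real q"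
      using assms(3) by (simp add: ceiling_le_iff sum_list_replicate field_simps)
    also have "\<dots> \<longleftrightarrow> k * n \<le> e * q" by (metis of_nat_le_iff of_nat_mult)
    finally show ?thesis .
  qed
  have P: "P e \<longleftrightarrow> k * n \<le> e * q \<and> \<not> e dvd n" for e
  proof (cases "e = 0")
    case True
    then have "\<not> k * n \<le> e * q" using assms by simp
    then show ?thesis unfolding P_def ce by blast
  next
    case False
    then show ?thesis using p_condition_replicate[of k e n] assms by (simp add: P_def ce)
  qed
  have d: "d = (LEAST e. P e)" by (simp add: d_def p_modulus_def P_def)
  \<comment> \<open>\<open>Suc (k * n)\<close> shows that the least number exists: it exceeds
    \<open>n\<close>, hence does not divide it, and it meets the size bound since \<open>q\<close>
    is positive.\<close>
  have "k * n * 1 \<le> Suc (k * n) * q" using assms(3) by (intro mult_le_mono) auto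
  moreover have "1 * n \<le> k * n" using assms(1) by (intro mult_le_mono1) simp
  then have "\<not> Suc (k * n) dvd n" using assms(2) by (intro nat_dvd_not_less) linarith+
  ultimately have "P (Suc (k * n))"
    unfolding P by simp
  then have "P d" unfolding d by (rule LeastI)
  then show "k * n \<le> d * q" "\<not> d dvd n" by (auto simp: P)
  show "e dvd n" if "k * n \<le> e * q" "e < d" for e
    using not_less_Least[of e P] that by (auto simp: d P)
qed

lemma nat_ceiling_divide_not_dvd:
  assumes "0 < d" "\<not> d dvd n"
  shows "nat \<lceil>real n / real d\<rceil> = Suc (n div d)"
proof -
  have "n div d * d < n" "n < Suc (n div d) * d"
    using assms by (metis dvd_triv_right le_neq_implies_less div_times_less_eq_dividend,
      metis dividend_less_div_times mult_Suc)
  then have "real (n div d) * real d < real n" "real n \<le> (real (n div d) + 1) * real d"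
    by (metis of_nat_less_iff of_nat_mult,
        metis Suc_eq_plus1 less_imp_le of_nat_1 of_nat_add of_nat_le_iff of_nat_mult)
  then have "\<lceil>real n / real d\<rceil> = int (Suc (n div d))"
    using assms(1) by (intro ceiling_unique) (auto simp: field_simps)
  then show ?thesis by simp
qed

text \<open>The class sizes \<open>m\<close> and \<open>m + 1\<close> realise an interval of colour numbers; for \<open>4 \<le> m < d\<close> the
  intervals of \<open>m - 1\<close> and \<open>m\<close> meet at \<open>k n / m\<close>, because \<open>m\<close> divides \<open>n\<close>.\<close>

lemma equitable_coloring_below_divisors:
  assumes "4 \<le> d" "\<And>e. 4 \<le> e \<Longrightarrow> e < d \<Longrightarrow> e dvd n"
    and "n \<le> t * d" "k * t \<le> q" "q \<le> k * (n div 3)"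
  shows "has_equitable_coloring (complete_equipartite k n) q"
  using assms
proof (induction d arbitrary: t rule: dec_induct)
  case base
  then show ?case
    by (intro equitable_coloring_complete_equipartite[of k t q "n div 3" n 3]) auto
next
  case (step d)
  show ?case
  proof (cases "q \<le> k * (n div d)")
    case True
    then show ?thesis using step.prems
      by (intro equitable_coloring_complete_equipartite[of k t q "n div d" n d]) auto
  next
    case False
    have "d dvd n" using step by auto
    \<comment> \<open>Exactly \<open>n div d\<close> classes of size \<open>d\<close> fill a part,
      so \<open>n div d\<close> is an admissible \<open>t\<close> for the smaller class sizes, and
      no color number is lost between the two cases.\<close>
    then show ?thesis using False step by (intro step.IH[of "n div d"]) auto
  qed
qed

text \<open>With \<open>d\<close> the modulus and \<open>t = n div d\<close>, the common value is
  \<open>k * Suc t\<close>: from there to \<open>k * b\<close> proper equitable colorings exist,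
  above \<open>k * b\<close> pairs and triples suffice, and \<open>k * Suc t - 1\<close> lies in the
  gap strictly between \<open>k * t\<close> and \<open>k * Suc t\<close>.\<close>

lemma arboricity_eq_p_number:
  assumes k: "2 \<le> k" and b: "1 \<le> b" and n: "n = 3 * b \<or> n = 3 * b + 1 \<and> k = 2"
  shows "strong_equitable_arboricity 1 (complete_equipartite k n) = p_number (k * b) (replicate k n)"
proof -
  define d where "d = p_modulus (k * b) (replicate k n)"
  have n0: "0 < n" "n div 3 = b" using n b by auto
  have kb: "0 < k * b" using k b by simp
  note d = p_modulus_replicate[OF k n0(1) kb, folded d_def]
  have le: "k * n \<le> e * (k * b) \<longleftrightarrow> n \<le> e * b" for e
    using k by (simp add: mult.left_commute[of e])
  \<comment> \<open>The modulus 3 is excluded because it divides \<open>n\<close> if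
    \<open>n = 3 * b\<close>, and because \<open>3 * b < n\<close> if
    \<open>n = 3 * b + 1\<close>.\<close>
  have "3 \<noteq> d" using d(1,2) unfolding le using n by auto
  moreover have "3 \<le> d"
  proof (rule ccontr)
    assume "\<not> 3 \<le> d"
    then have "d * b \<le> 2 * b" by (intro mult_le_mono1) simp
    then show False using d(1) n b unfolding le by linarith
  qed
  ultimately have d4: "4 \<le> d" by simp
  have dv: "e dvd n" if "4 \<le> e" "e < d" for e
  proof -
    \<comment> \<open>As \<open>b \<ge> 1\<close>, \<open>n \<le> 4 * b\<close>; so every
      \<open>e \<ge> 4\<close> passes the size bound, and by minimality of \<open>d\<close> it can
      only fail by dividing \<open>n\<close>.\<close>
    have "4 * b \<le> e * b" using that by (intro mult_le_mono1)
    then have "n \<le> e * b" using n b by linarith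
    then show ?thesis using d(3)[of e] that le by blast
  qed
  define t where "t = n div d"
  have t: "t * d < n" "n < Suc t * d"
    using d(2) d4 unfolding t_def
    by (metis dvd_triv_right le_neq_implies_less div_times_less_eq_dividend)
      (use d4 dividend_less_div_times[of d n] in \<open>simp add: t_def\<close>)
  have "Suc t \<le> b"
  proof (rule ccontr)
    assume "\<not> Suc t \<le> b"
    then have "b * 4 \<le> t * d" using d4 by (intro mult_le_mono) auto
    then show False using t(1) n b by auto
  qed
  then have tb: "k * Suc t \<le> k * b" by (rule mult_le_mono2)
  have col: "has_equitable_coloring (complete_equipartite k n) q" if "k * Suc t \<le> q" "q \<le> k * b" for q
    using equitable_coloring_below_divisors[OF d4 dv, of "Suc t" k q] t that n0 by auto
  \<comment> \<open>The coloring with \<open>k * b\<close> classes selects the defined branch of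
    \<open>p_number\<close>; each of the \<open>k\<close> summands is \<open>Suc t\<close>.\<close>
  have "p_number (k * b) (replicate k n) = k * Suc t"
    using col[OF tb order.refl] nat_ceiling_divide_not_dvd[of d n] d(2) d4
    by (simp add: p_number_def d_def[symmetric] sum_list_replicate t_def)
  moreover have "strong_equitable_arboricity 1 (complete_equipartite k n) = k * Suc t"
  proof (rule strong_equitable_arboricity_eqI)
    fix q assume q: "k * Suc t \<le> q"
    show "has_equitable_tree_coloring (complete_equipartite k n) q 1"
    proof (cases "q \<le> k * b")
      case True
      then show ?thesis
        using col q has_equitable_tree_coloring_of_equitable_coloring by blast
    next
      case False
      show ?thesis
        by (rule tree_coloring_large, unfold n0(2)) (use n False in \<open>auto simp: algebra_simps\<close>)
    qed
  next
    show "\<not> has_equitable_tree_coloring (complete_equipartite k n) (k * Suc t - 1) 1"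
    proof (rule no_tree_coloring_between[OF _ t])
      have "3 * (k * Suc t - 1) \<le> 3 * (k * b)" using tb by simp
      also have "\<dots> \<le> k * n" using n by auto
      finally show "3 * (k * Suc t - 1) \<le> k * n" .
    qed (use k in auto)
  qed (use k in auto)
  ultimately show ?thesis by simp
qed

theorem theorem3:
  fixes k b :: nat
  assumes "k \<ge> 3" and "b \<ge> 1"
  shows
    "(strong_equitable_arboricity 1 (complete_multipartite [1, 1]) = 1 \<and>
      strong_equitable_arboricity 1 (complete_multipartite (replicate k 1)) = nat \<lceil>real k / 2\<rceil>) \<and>
     (strong_equitable_arboricity 1 (complete_multipartite [2, 2]) = 2 \<and>
      strong_equitable_arboricity 1 (complete_multipartite (replicate k 2)) = k) \<and>
     (\<forall>n. n = 3 * b \<longrightarrow>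
        strong_equitable_arboricity 1 (complete_multipartite [n, n]) = p_number (2 * b) [n, n] \<and>
        strong_equitable_arboricity 1 (complete_multipartite (replicate k n)) =
          p_number (k * b) (replicate k n)) \<and>
     (\<forall>n. n = 3 * b + 1 \<longrightarrow>
        strong_equitable_arboricity 1 (complete_multipartite [n, n]) = p_number (2 * b) [n, n] \<and>
        strong_equitable_arboricity 1 (complete_multipartite (replicate k n)) =
          k * b + nat \<lceil>real k / 2\<rceil>) \<and>
     (\<forall>n. n = 3 * b + 2 \<longrightarrow>
        strong_equitable_arboricity 1 (complete_multipartite [n, n]) = 2 * b + 2 \<and>
        strong_equitable_arboricity 1 (complete_multipartite (replicate k n)) = k * b + k)"
proof -
  \<comment> \<open>Two parts become the case \<open>k = 2\<close>, so that the lemmas on equal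
    parts apply.\<close>
  have two: "[n, n] = replicate 2 n" for n :: nat by (simp add: numeral_2_eq_2)
  have k: "2 \<le> k" using assms(1) by simp
  show ?thesis
    unfolding two
  proof (intro conjI allI impI)
    show "strong_equitable_arboricity 1 (complete_equipartite 2 1) = 1"
      \<comment> \<open>The value \<open>b = 0\<close> in the remainder lemmas yields the part sizes
        1 and 2.\<close>
      using arboricity_remainder_1[of 2 1 0] by simp
    show "strong_equitable_arboricity 1 (complete_equipartite k 1) = nat \<lceil>real k / 2\<rceil>"
      using arboricity_remainder_1[of k 1 0] k by simp
    show "strong_equitable_arboricity 1 (complete_equipartite 2 2) = 2"
      using arboricity_remainder_2[of 2 2 0] by simp
    show "strong_equitable_arboricity 1 (complete_equipartite k 2) = k"
      using arboricity_remainder_2[of k 2 0] k by simp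
  next
    fix n assume n: "n = 3 * b"
    show "strong_equitable_arboricity 1 (complete_equipartite 2 n) = p_number (2 * b) (replicate 2 n)"
      "strong_equitable_arboricity 1 (complete_equipartite k n) = p_number (k * b) (replicate k n)"
      using arboricity_eq_p_number[of _ b n] n k assms(2) by blast+
  next
    fix n assume n: "n = 3 * b + 1"
    show "strong_equitable_arboricity 1 (complete_equipartite 2 n) = p_number (2 * b) (replicate 2 n)"
      using arboricity_eq_p_number[of 2 b n] n assms(2) by blast
    show "strong_equitable_arboricity 1 (complete_equipartite k n) = k * b + nat \<lceil>real k / 2\<rceil>"
      using arboricity_remainder_1[of k n b] n k assms(1) by blast
  next
    fix n assume n: "n = 3 * b + 2"
    show "strong_equitable_arboricity 1 (complete_equipartite 2 n) = 2 * b + 2"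
      "strong_equitable_arboricity 1 (complete_equipartite k n) = k * b + k"
      using arboricity_remainder_2[of _ n b] n k by blast+
  qed
qed

end
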